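(* Let $T\ge 2$ and $n\ge 1$ be integers, let $0\le m_i\le n$ be integers for $1\le i\le T$, and let $0\le t\le T$. Then $$E(x_{\ge t})=E(x_t)+E(x_{\ge t+1})=\sum_{i=t}^{T}E(x_i).$$
   Context: General hypergeometric distribution: let $N$ be a finite set with $n$ elements. Choose subsets $M_1,\dots,M_T$ of $N$ independently, $M_i$ being uniformly distributed among all $\binom{n}{m_i}$ subsets of $N$ of size $m_i$. The random variable $x_t$ (respectively $x_{\ge t}$) is the number of elements of $N$ that belong to exactly $t$ (respectively at least $t$) of the sets $M_1,\dots,M_T$; thus $x_{\ge T+1}=0$. *)

theory Defs
  imports "HOL-Probability.Probability" "HOL-Probability.Product_PMF"
begin

(* Joint law of independent M_1, ..., M_T, each M_i uniform on the m_i-subsets of N.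
   pmf_of_set is only meaningful on finite nonempty sets, i.e. for finite N with m i <= card N.
   Outside {1..T} the family takes the dummy value {}. *)
definition random_subsets :: "'a set \<Rightarrow> nat \<Rightarrow> (nat \<Rightarrow> nat) \<Rightarrow> (nat \<Rightarrow> 'a set) pmf" where
  "random_subsets N T m =
     Pi_pmf {1..T} {} (\<lambda>i. pmf_of_set {A. A \<subseteq> N \<and> card A = m i})"

definition multiplicity_in :: "nat \<Rightarrow> (nat \<Rightarrow> 'a set) \<Rightarrow> 'a \<Rightarrow> nat" where
  "multiplicity_in T M a = card {i \<in> {1..T}. a \<in> M i}"

definition x_exactly :: "'a set \<Rightarrow> nat \<Rightarrow> nat \<Rightarrow> (nat \<Rightarrow> 'a set) \<Rightarrow> nat" where
  "x_exactly N T t M = card {a \<in> N. multiplicity_in T M a = t}"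

definition x_at_least :: "'a set \<Rightarrow> nat \<Rightarrow> nat \<Rightarrow> (nat \<Rightarrow> 'a set) \<Rightarrow> nat" where
  "x_at_least N T t M = card {a \<in> N. multiplicity_in T M a \<ge> t}"

end

theory Submission
  imports Defs
begin

text \<open>
  Both equations already hold pointwise, before expectations are taken. An element lying in at
  least \<open>t\<close> of the sets lies either in exactly \<open>t\<close> of them or in at least \<open>t + 1\<close>, and never in
  both situations (\<open>x_at_least_step\<close>). Since no element lies in more than \<open>T\<close> of the sets, the
  elements counted by \<open>x_at_least\<close> split according to their multiplicity, which ranges over
  \<open>{t..T}\<close> (\<open>x_at_least_eq_sum\<close>). Linearity of expectation transfers the identities: all the counts are
  bounded by the size of the ground set, hence integrable (\<open>integrable_card_filter\<close>).
\<close>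

lemma multiplicity_in_le: "multiplicity_in T M a \<le> T"
proof -
  have "multiplicity_in T M a \<le> card {1..T}"
    unfolding multiplicity_in_def by (rule card_mono) auto
  then show ?thesis by simp
qed

lemma x_at_least_step:
  assumes "finite N"
  shows "x_at_least N T t M = x_exactly N T t M + x_at_least N T (t + 1) M"
proof -
  have "{a \<in> N. multiplicity_in T M a \<ge> t} =
      {a \<in> N. multiplicity_in T M a = t} \<union> {a \<in> N. multiplicity_in T M a \<ge> t + 1}"
    by auto
  then show ?thesis
    unfolding x_at_least_def x_exactly_def using assms by (simp add: card_Un_disjoint disjoint_iff)
qed

lemma x_at_least_eq_sum:
  assumes "finite N"
  shows "x_at_least N T t M = (\<Sum>i=t..T. x_exactly N T i M)"
proof -
  have "{a \<in> N. multiplicity_in T M a \<ge> t} =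
      (\<Union>i\<in>{t..T}. {a \<in> N. multiplicity_in T M a = i})"
    using multiplicity_in_le[of T M] by auto
  then show ?thesis
    unfolding x_at_least_def x_exactly_def
    using assms by (simp add: card_UN_disjoint disjoint_iff)
qed

lemma integrable_card_filter:
  fixes p :: "'b pmf"
  assumes "finite N"
  shows "integrable (measure_pmf p) (\<lambda>M. real (card {a \<in> N. P M a}))"
proof (rule measure_pmf.integrable_const_bound)
  show "AE M in measure_pmf p. norm (real (card {a \<in> N. P M a})) \<le> real (card N)"
    using assms by (auto intro!: card_mono)
qed simp

theorem theorem3p2:
  fixes N :: "'a set" and n T t :: nat and m :: "nat \<Rightarrow> nat"
  assumes "T \<ge> 2" and "n \<ge> 1"
    and "finite N" and "card N = n"
    and "\<And>i. 1 \<le> i \<Longrightarrow> i \<le> T \<Longrightarrow> m i \<le> n"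
    and "t \<le> T"
  shows "measure_pmf.expectation (random_subsets N T m) (\<lambda>M. real (x_at_least N T t M))
       = measure_pmf.expectation (random_subsets N T m) (\<lambda>M. real (x_exactly N T t M))
         + measure_pmf.expectation (random_subsets N T m) (\<lambda>M. real (x_at_least N T (t + 1) M))
     \<and> measure_pmf.expectation (random_subsets N T m) (\<lambda>M. real (x_exactly N T t M))
         + measure_pmf.expectation (random_subsets N T m) (\<lambda>M. real (x_at_least N T (t + 1) M))
       = (\<Sum>i=t..T. measure_pmf.expectation (random_subsets N T m) (\<lambda>M. real (x_exactly N T i M)))"
proof -
  let ?p = "random_subsets N T m"
  let ?E = "measure_pmf.expectation ?p"
  have int_ge: "integrable ?p (\<lambda>M. real (x_at_least N T i M))" for i
    unfolding x_at_least_def by (rule integrable_card_filter[OF \<open>finite N\<close>])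
  have int_eq: "integrable ?p (\<lambda>M. real (x_exactly N T i M))" for i
    unfolding x_exactly_def by (rule integrable_card_filter[OF \<open>finite N\<close>])
  have step: "?E (\<lambda>M. real (x_at_least N T t M)) =
      ?E (\<lambda>M. real (x_exactly N T t M)) + ?E (\<lambda>M. real (x_at_least N T (t + 1) M))"
    unfolding x_at_least_step[OF \<open>finite N\<close>, of T t] of_nat_add
    by (rule Bochner_Integration.integral_add[OF int_eq int_ge])
  have "?E (\<lambda>M. real (x_at_least N T t M)) = (\<Sum>i=t..T. ?E (\<lambda>M. real (x_exactly N T i M)))"
    unfolding x_at_least_eq_sum[OF \<open>finite N\<close>] of_nat_sum
    by (rule Bochner_Integration.integral_sum[OF int_eq])
  with step show ?thesis by simp
qed

end
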